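(* Let $A$ be a real $n\times n$ $\mathbf{P}$-matrix and let $k$ be an odd natural number. Then the tensor $\mathcal{A}$ of order $m=k+1$ and dimension $n$ defined by $\mathcal{A}x^{m-1}=(Ax)^{[k]}$ has the $\mathbf{GUS}$-property as well as the strong $\mathbf{Q}$-property.
   Context: A real square matrix is a $\mathbf{P}$-matrix if all its principal minors are positive (no symmetry is assumed). For $y\in\mathbb{R}^n$, $y^{[k]}$ is the vector with components $(y_i)^k$. A tensor of order $m$ and dimension $n$ is an array $\mathcal{A}=[a_{i_1\cdots i_m}]$ of reals with indices in $\{1,\dots,n\}$; $\mathcal{A}x^{m-1}$ is the homogeneous polynomial map of degree $m-1$ with components $(\mathcal{A}x^{m-1})_i=\sum_{i_2,\dots,i_m} a_{ii_2\cdots i_m}x_{i_2}\cdots x_{i_m}$. The notions below depend on $\mathcal{A}$ only through $F(x):=\mathcal{A}x^{m-1}$. For a polynomial map $f:\mathbb{R}^n\to\mathbb{R}^n$ and $q\in\mathbb{R}^n$, $\mathrm{PCP}(f,q)$ is the problem of finding $x$ with $x\ge 0$, $f(x)+q\ge 0$ (componentwise), $\langle x,f(x)+q\rangle=0$. $\mathcal{A}$ has the $\mathbf{GUS}$-property if $\mathrm{PCP}(F,q)$ has a unique solution for every $q\in\mathbb{R}^n$. $\mathcal{A}$ has the strong $\mathbf{Q}$-property if $\mathrm{PCP}(F+P,q)$ has a nonempty compact solution set for all $q\in\mathbb{R}^n$ and all polynomial maps $P:\mathbb{R}^n\to\mathbb{R}^n$ of degree less than $m-1$. *)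

theory Defs
  imports "HOL-Analysis.Analysis"
begin

(* The determinant of the principal submatrix of A with rows and columns in S, written out by
   the Leibniz formula because S is a subset of the index type rather than a type; the lemma
   principal_minor_eq_det below relates it to the determinant of the library. *)
definition principal_minor :: "real^'n^'n \<Rightarrow> 'n set \<Rightarrow> real" where
  "principal_minor A S = (\<Sum>p | p permutes S. of_int (sign p) * (\<Prod>i\<in>S. A $ i $ p i))"

definition P_matrix :: "real^'n^'n \<Rightarrow> bool" where
  "P_matrix A \<longleftrightarrow> (\<forall>S. S \<noteq> {} \<longrightarrow> principal_minor A S > 0)"

definition vec_power :: "real^'n \<Rightarrow> nat \<Rightarrow> real^'n" where
  "vec_power y k = (\<chi> i. (y $ i) ^ k)"

(* A tensor of order m and dimension CARD('n): the entry with indices i_1, ..., i_m is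
   T [i_1, ..., i_m]. The values of T on lists of length other than m are never used. *)
type_synonym 'n tensor = "'n list \<Rightarrow> real"

definition tensor_map :: "nat \<Rightarrow> 'n tensor \<Rightarrow> real^'n \<Rightarrow> real^'n" where
  "tensor_map m T x =
     (\<chi> i. \<Sum>js | length js = m - 1. T (i # js) * (\<Prod>j\<leftarrow>js. x $ j))"

definition PCP_solutions :: "(real^'n \<Rightarrow> real^'n) \<Rightarrow> real^'n \<Rightarrow> (real^'n) set" where
  "PCP_solutions f q =
     {x. (\<forall>i. 0 \<le> x $ i) \<and> (\<forall>i. 0 \<le> (f x + q) $ i) \<and> x \<bullet> (f x + q) = 0}"

(* Each component is a linear combination of the monomials with exponent vector \<alpha> of total
   degree less than d; so for d = 0 only the zero map qualifies, for d = 1 the constant maps. *)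
definition polynomial_map_degree_less :: "nat \<Rightarrow> (real^'n \<Rightarrow> real^'n) \<Rightarrow> bool" where
  "polynomial_map_degree_less d P \<longleftrightarrow>
     (\<forall>i. \<exists>c :: ('n \<Rightarrow> nat) \<Rightarrow> real.
        \<forall>x. P x $ i = (\<Sum>\<alpha> | (\<Sum>j\<in>UNIV. \<alpha> j) < d. c \<alpha> * (\<Prod>j\<in>UNIV. (x $ j) ^ \<alpha> j)))"

definition GUS_property :: "nat \<Rightarrow> 'n::finite tensor \<Rightarrow> bool" where
  "GUS_property m T \<longleftrightarrow> (\<forall>q. \<exists>!x. x \<in> PCP_solutions (tensor_map m T) q)"

definition strong_Q_property :: "nat \<Rightarrow> 'n::finite tensor \<Rightarrow> bool" where
  "strong_Q_property m T \<longleftrightarrow>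
     (\<forall>P q. polynomial_map_degree_less (m - 1) P \<longrightarrow>
        PCP_solutions (\<lambda>x. tensor_map m T x + P x) q \<noteq> {} \<and>
        compact (PCP_solutions (\<lambda>x. tensor_map m T x + P x) q))"

lemma principal_minor_eq_det:
  fixes A :: "real^'n^'n" and f :: "'m::finite \<Rightarrow> 'n"
  assumes "inj f"
  shows "principal_minor A (range f) = det (\<chi> i j. A $ f i $ f j)"
proof -
  have fb: "bij_betw f UNIV (range f)"
    using assms by (simp add: bij_betw_def)
  have inv_f: "inv_into UNIV f (f x) = x" for x
    using assms by simp
  have gb: "bij_betw (inv_into UNIV f) (range f) UNIV"
    by (rule bij_betw_inv_into[OF fb])
  show ?thesis
    unfolding principal_minor_def det_def
  proof (rule sum.reindex_bij_witness[where i = "map_permutation UNIV f"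
        and j = "map_permutation (range f) (inv_into UNIV f)"], goal_cases)
    case (1 p)
    then show ?case
      by (intro map_permutation_compose_inv[OF gb]) (auto simp: f_inv_into_f)
  next
    case (2 p)
    then show ?case
      using map_permutation_permutes[OF gb] by auto
  next
    case (3 p)
    then show ?case
      by (intro map_permutation_compose_inv[OF fb]) (auto simp: inv_f)
  next
    case (4 p)
    then show ?case
      using map_permutation_permutes[OF fb] by auto
  next
    case (5 p)
    then have p: "p permutes range f" by simp
    have injg: "inj_on (inv_into UNIV f) (range f)"
      using gb by (simp add: bij_betw_def)
    have s: "sign (map_permutation (range f) (inv_into UNIV f) p) = sign p"
      by (rule sign_map_permutation) (use p injg in auto)
    have e: "f (map_permutation (range f) (inv_into UNIV f) p i) = p (f i)" for i
    proof -
      have "map_permutation (range f) (inv_into UNIV f) p (inv_into UNIV f (f i))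
            = inv_into UNIV f (p (f i))"
        by (rule map_permutation_apply) (use p injg in auto)
      moreover have "p (f i) \<in> range f"
        using permutes_in_image[OF p] by blast
      ultimately show ?thesis
        by (simp add: inv_f f_inv_into_f)
    qed
    have "(\<Prod>i\<in>range f. A $ i $ p i) = (\<Prod>i\<in>UNIV. A $ f i $ p (f i))"
      using assms by (simp add: prod.reindex)
    then show ?case
      by (simp add: s e)
  qed
qed

lemma finite_exponents_degree_less:
  "finite {\<alpha> :: 'n::finite \<Rightarrow> nat. (\<Sum>j\<in>UNIV. \<alpha> j) < d}"
proof (rule finite_subset)
  show "{\<alpha> :: 'n \<Rightarrow> nat. (\<Sum>j\<in>UNIV. \<alpha> j) < d} \<subseteq> PiE UNIV (\<lambda>_. {..<d})"
  proof (intro subsetI PiE_I)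
    fix \<alpha> :: "'n \<Rightarrow> nat" and i :: 'n
    assume "\<alpha> \<in> {\<alpha>. (\<Sum>j\<in>UNIV. \<alpha> j) < d}"
    moreover have "\<alpha> i \<le> (\<Sum>j\<in>UNIV. \<alpha> j)"
      by (rule member_le_sum) auto
    ultimately show "\<alpha> i \<in> {..<d}" by simp
  qed auto
  show "finite (PiE (UNIV :: 'n set) (\<lambda>_. {..<d}))"
    by (intro finite_PiE) auto
qed

lemma finite_index_lists: "finite {js :: 'n::finite list. length js = l}"
  using finite_lists_length_eq[of "UNIV :: 'n set" l] by simp

lemma sum_prod_list_power:
  fixes a :: "'n::finite \<Rightarrow> real"
  shows "(\<Sum>js | length js = l. \<Prod>j\<leftarrow>js. a j) = (\<Sum>j\<in>UNIV. a j) ^ l"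
proof (induction l)
  case 0
  then show ?case by simp
next
  case (Suc l)
  have eq: "{js :: 'n list. length js = Suc l}
      = (\<lambda>(j, js). j # js) ` (UNIV \<times> {js. length js = l})"
    by (force simp: length_Suc_conv)
  have "(\<Sum>js | length js = Suc l. \<Prod>j\<leftarrow>js. a j)
      = (\<Sum>(j, js)\<in>UNIV \<times> {js. length js = l}. a j * (\<Prod>j\<leftarrow>js. a j))"
    unfolding eq by (subst sum.reindex) (auto simp: inj_on_def case_prod_unfold)
  also have "\<dots> = (\<Sum>j\<in>UNIV. a j) * (\<Sum>js | length js = l. \<Prod>j\<leftarrow>js. a j)"
    by (simp add: sum.cartesian_product[symmetric] sum_product)
  finally show ?case
    using Suc by simp
qed

lemma prod_list_mult_real:
  fixes f g :: "'b \<Rightarrow> real"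
  shows "(\<Prod>j\<leftarrow>js. f j) * (\<Prod>j\<leftarrow>js. g j) = (\<Prod>j\<leftarrow>js. f j * g j)"
  by (induction js) (simp_all add: algebra_simps)

(* The tensor with entries A_{i i_2} ... A_{i i_m} has the map x \<mapsto> (Ax)^[k], so the equation
   defining a tensor by this map always has a solution. *)
lemma tensor_map_vec_power_exists:
  fixes A :: "real^'n^'n"
  shows "\<exists>T. \<forall>x. tensor_map (k + 1) T x = vec_power (A *v x) k"
proof (intro exI allI)
  fix x
  show "tensor_map (k + 1) (\<lambda>is. \<Prod>j\<leftarrow>tl is. A $ hd is $ j) x = vec_power (A *v x) k"
    by (simp add: tensor_map_def vec_power_def vec_eq_iff prod_list_mult_real
        sum_prod_list_power matrix_vector_mult_def)
qed

end

theory Submission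
  imports Defs
begin

text \<open>By multilinearity in the rows, adding a nonnegative diagonal to a P-matrix keeps the principal
  minors positive, so \<open>x\<^sub>i (A x)\<^sub>i > 0\<close> for some \<open>i\<close> whenever \<open>x \<noteq> 0\<close>. Since odd powers are strictly
  increasing, two distinct solutions \<open>x\<close>, \<open>y\<close> would contradict this for \<open>x - y\<close>.
  On the unit sphere compactness gives a positive lower bound, so the homogeneous part of degree
  \<open>k\<close> dominates every perturbation of lower degree; this bounds all solutions a priori, and
  Brouwer's theorem on a large box yields existence without degree theory.\<close>

section \<open>Principal minors and sign reversal for P-matrices\<close>

text \<open>A permutation that moves some index outside \<open>S\<close> meets a zero of an identity
  row, so only permutations of \<open>S\<close> survive in the Leibniz formula. This makes
  row-linearity of \<open>det\<close> available for principal minors.\<close>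

lemma det_identity_rows_outside:
  fixes A :: "real^'n^'n"
  shows "det (\<chi> i. if i \<in> S then A $ i else axis i 1) = principal_minor A S"
proof -
  let ?M = "(\<chi> i. if i \<in> S then A $ i else axis i 1) :: real^'n^'n"
  have "principal_minor A S = (\<Sum>p | p permutes S. of_int (sign p) * (\<Prod>i\<in>UNIV. ?M $ i $ p i))"
    unfolding principal_minor_def
  proof (intro sum.cong refl arg_cong2[where f = "(*)"])
    fix p assume p: "p \<in> {p. p permutes S}"
    have "(\<Prod>i\<in>S. A $ i $ p i) = (\<Prod>i\<in>S. ?M $ i $ p i)"
      by simp
    also have "\<dots> = (\<Prod>i\<in>UNIV. ?M $ i $ p i)"
      using p by (intro prod.mono_neutral_left) (auto simp: permutes_not_in axis_def)
    finally show "(\<Prod>i\<in>S. A $ i $ p i) = (\<Prod>i\<in>UNIV. ?M $ i $ p i)" .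
  qed
  also have "\<dots> = (\<Sum>p | p permutes UNIV. of_int (sign p) * (\<Prod>i\<in>UNIV. ?M $ i $ p i))"
  proof (intro sum.mono_neutral_left ballI)
    fix p :: "'n \<Rightarrow> 'n" assume "p \<in> {p. p permutes UNIV} - {p. p permutes S}"
    then obtain i where "i \<notin> S" "p i \<noteq> i"
      by (auto simp: permutes_def)
    then have "?M $ i $ p i = 0"
      by (simp add: axis_def)
    then have "(\<Prod>i\<in>UNIV. ?M $ i $ p i) = 0"
      by (intro prod_zero bexI[of _ i]) simp_all
    then show "of_int (sign p) * (\<Prod>i\<in>UNIV. ?M $ i $ p i) = 0"
      by simp
  qed (auto intro: permutes_subset)
  finally show ?thesis
    by (simp add: det_def)
qed

text \<open>\<open>U\<close> holds the rows that have received their diagonal term. For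
  \<open>u\<close> in \<open>S\<close>, splitting row \<open>u\<close> gives the determinant without
  that term plus \<open>d u\<close> times one whose row \<open>u\<close> is an identity row. The
  latter has \<open>S - {u}\<close> in place of \<open>S\<close>, so the induction needs
  \<open>S\<close> arbitrary.\<close>

lemma P_matrix_det_add_diagonal_pos:
  fixes A :: "real^'n^'n" and d :: "'n \<Rightarrow> real"
  assumes A: "P_matrix A" and d: "\<And>i. 0 \<le> d i" and "finite U"
  shows "0 < det (\<chi> i. if i \<in> S then A $ i + (if i \<in> U then d i *s axis i 1 else 0) else axis i 1)"
  using \<open>finite U\<close>
proof (induction U arbitrary: S)
  case empty
  have "0 < principal_minor A S"
    using A by (cases "S = {}") (auto simp: P_matrix_def principal_minor_def)
  then show ?case
    using det_identity_rows_outside[of S A] by (simp cong: if_cong)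
next
  case (insert u U)
  let ?M = "\<lambda>U S. (\<chi> i. if i \<in> S then A $ i + (if i \<in> U then d i *s axis i 1 else 0)
      else axis i 1) :: real^'n^'n"
  show ?case
  proof (cases "u \<in> S")
    case False
    then have "?M (insert u U) S = ?M U S"
      by (auto simp: vec_eq_iff)
    then show ?thesis
      using insert.IH[of S] by simp
  next
    case True
    let ?r = "\<lambda>v. (\<chi> i. if i = u then v else ?M U S $ i) :: real^'n^'n"
    have "?M (insert u U) S = ?r (A $ u + d u *s axis u 1)"
      using True by (auto simp: vec_eq_iff)
    moreover have "?r (A $ u) = ?M U S"
      using True insert.hyps by (auto simp: vec_eq_iff)
    moreover have "?r (axis u 1) = ?M U (S - {u})"
      by (auto simp: vec_eq_iff)
    ultimately have "det (?M (insert u U) S) = det (?M U S) + d u * det (?M U (S - {u}))"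
      by (simp only: det_row_add det_row_mul)
    then show ?thesis
      using insert.IH[of S] insert.IH[of "S - {u}"] d[of u] by (simp add: add_pos_nonneg)
  qed
qed

text \<open>If \<open>x\<^sub>i (A x)\<^sub>i \<le> 0\<close> for all \<open>i\<close>, then \<open>x\<close> lies in the kernel of \<open>A\<close> with nonnegative entries
  \<open>- (A x)\<^sub>i / x\<^sub>i\<close> added to the diagonal on the support of \<open>x\<close>.\<close>

lemma P_matrix_no_sign_reversal:
  fixes A :: "real^'n^'n"
  assumes A: "P_matrix A" and x: "x \<noteq> 0"
  shows "\<exists>i. 0 < x $ i * (A *v x) $ i"
proof (rule ccontr)
  assume "\<not> ?thesis"
  then have le: "x $ i * (A *v x) $ i \<le> 0" for i
    by (simp add: not_less)
  \<comment> \<open>Division by zero gives \<open>d i = 0\<close> wherever \<open>x $ i = 0\<close>,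
    so \<open>d\<close> is nonnegative everywhere.\<close>
  define d where "d i = - (A *v x) $ i / x $ i" for i
  have d: "0 \<le> d i" for i
    using le[of i] by (auto simp: d_def divide_simps mult_le_0_iff)
  \<comment> \<open>Off the support of \<open>x\<close>, an identity row annihilates
    \<open>x\<close> too. The phrasing matches the determinant lemma with the support as
    \<open>S\<close> and \<open>UNIV\<close> as \<open>U\<close>.\<close>
  define M :: "real^'n^'n" where "M = (\<chi> i. if i \<in> {i. x $ i \<noteq> 0}
    then A $ i + (if i \<in> UNIV then d i *s axis i 1 else 0) else axis i 1)"
  have ax: "(\<Sum>j\<in>UNIV. axis i 1 $ j * x $ j) = x $ i" for i
    by (simp add: axis_def if_distrib if_distribR cong: if_cong)
  have "(M *v x) $ i = 0" for i
  proof (cases "x $ i = 0")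
    case True
    then show ?thesis
      using ax by (simp add: M_def matrix_vector_mult_def)
  next
    case False
    have "(M *v x) $ i = (A *v x) $ i + d i * (\<Sum>j\<in>UNIV. axis i 1 $ j * x $ j)"
      using False
      by (simp add: M_def matrix_vector_mult_def distrib_right sum.distrib sum_distrib_left mult.assoc)
    then show ?thesis
      using False by (simp add: ax d_def)
  qed
  then have "M *v x = 0"
    by (simp add: vec_eq_iff)
  then have "\<not> invertible M"
    using x matrix_left_invertible_ker[of M] by (auto simp: invertible_left_inverse)
  then have "det M = 0"
    by (simp add: invertible_det_nz)
  moreover have "0 < det M"
    unfolding M_def by (rule P_matrix_det_add_diagonal_pos[OF A d]) simp
  ultimately show False
    by simp
qed

section \<open>Complementarity problems: uniqueness, and existence from an a priori bound\<close>

lemma power_strict_mono_odd: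
  fixes a b :: real
  assumes "odd k" "a < b"
  shows "a ^ k < b ^ k"
proof -
  have "a ^ k \<noteq> b ^ k"
    using assms odd_real_root_power_cancel by (metis less_irrefl)
  then show ?thesis
    using power_mono_odd[OF assms(1), of a b] assms(2) by simp
qed

text \<open>A sum of nonnegative terms vanishes only termwise; the later arguments look at single
  components.\<close>

lemma PCP_solutions_iff:
  "x \<in> PCP_solutions f q \<longleftrightarrow>
     (\<forall>i. 0 \<le> x $ i \<and> 0 \<le> (f x + q) $ i \<and> x $ i * (f x + q) $ i = 0)"
proof -
  have "x \<bullet> (f x + q) = 0 \<longleftrightarrow> (\<forall>i. x $ i * (f x + q) $ i = 0)"
    if "\<And>i. 0 \<le> x $ i" "\<And>i. 0 \<le> (f x + q) $ i"
    using that unfolding inner_vec_def inner_real_def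
    by (subst sum_nonneg_eq_0_iff) (auto intro!: mult_nonneg_nonneg)
  then show ?thesis
    unfolding PCP_solutions_def by blast
qed

lemma PCP_vec_power_unique:
  fixes A :: "real^'n^'n"
  assumes A: "P_matrix A" and k: "odd k"
    and x: "x \<in> PCP_solutions (\<lambda>x. vec_power (A *v x) k) q"
    and y: "y \<in> PCP_solutions (\<lambda>x. vec_power (A *v x) k) q"
  shows "x = y"
proof (rule ccontr)
  assume "x \<noteq> y"
  then obtain i where i: "0 < (x - y) $ i * (A *v (x - y)) $ i"
    using P_matrix_no_sign_reversal[OF A, of "x - y"] by auto
  define u v where "u = (A *v x) $ i" and "v = (A *v y) $ i"
  have "0 < (x $ i - y $ i) * (u - v)"
    using i by (simp add: u_def v_def matrix_vector_mult_diff_distrib)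
  \<comment> \<open>The difference of the odd powers has the sign of \<open>u - v\<close>, and
    \<open>q\<close> cancels.\<close>
  then have "0 < (x $ i - y $ i) * ((u ^ k + q $ i) - (v ^ k + q $ i))"
    using power_strict_mono_odd[OF k, of u v] power_strict_mono_odd[OF k, of v u]
    by (auto simp: zero_less_mult_iff)
  moreover have "0 \<le> x $ i" "0 \<le> u ^ k + q $ i" "x $ i * (u ^ k + q $ i) = 0"
    "0 \<le> y $ i" "0 \<le> v ^ k + q $ i" "y $ i * (v ^ k + q $ i) = 0"
    using x y by (auto simp: PCP_solutions_iff vec_power_def u_def v_def)
  \<comment> \<open>Expanding the product leaves only \<open>- (a * e) - b * c\<close>.\<close>
  moreover have "(a - b) * (c - e) \<le> 0"
    if "0 \<le> a" "0 \<le> b" "0 \<le> c" "0 \<le> e" "a * c = 0" "b * e = 0" for a b c e :: real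
    using that by (auto simp: mult_nonneg_nonneg)
  ultimately show False
    by (meson not_less)
qed

text \<open>A Brouwer fixed point of \<open>x \<mapsto> x - g x\<close>, clamped to a box, satisfies \<open>x\<^sub>i g\<^sub>i(x) \<le> 0\<close> for
  all \<open>i\<close>. The a priori bound then keeps it away from the upper faces of the box, where
  \<open>g\<^sub>i(x) < 0\<close> would be possible.\<close>

lemma PCP_solutions_nonempty_compact:
  fixes f :: "real^'n \<Rightarrow> real^'n"
  assumes cont: "continuous_on UNIV f"
    and bound: "\<And>x. (\<And>i. x $ i * (f x + q) $ i \<le> 0) \<Longrightarrow> norm x \<le> R"
  shows "PCP_solutions f q \<noteq> {} \<and> compact (PCP_solutions f q)"
proof
  have R: "0 \<le> R"
    using bound[of 0] by simp
  \<comment> \<open>The margin 1 keeps points of norm at most \<open>R\<close> strictly below the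
    upper faces of the box.\<close>
  define r where "r = R + 1"
  define g where "g x = f x + q" for x
  have contg: "continuous_on UNIV g"
    unfolding g_def by (intro continuous_intros cont)
  define B where "B = cbox (0 :: real^'n) (\<chi> i. r)"
  have B: "x \<in> B \<longleftrightarrow> (\<forall>i. 0 \<le> x $ i \<and> x $ i \<le> r)" for x
    by (simp add: B_def mem_box_cart)
  define h where "h x = (\<chi> i. max 0 (min r (x $ i - g x $ i)))" for x
  have "continuous_on UNIV h"
    unfolding h_def by (intro continuous_intros contg)
  then have "continuous_on B h"
    by (rule continuous_on_subset) simp
  moreover have "h \<in> B \<rightarrow> B"
    using R by (auto simp: B h_def r_def)
  moreover have "0 \<in> B"
    using R by (simp add: B r_def)
  ultimately obtain x where x: "x \<in> B" "h x = x"
    using brouwer[of B h] by (auto simp: B_def convex_box)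
  have xi: "0 \<le> x $ i" "x $ i \<le> r" "x $ i = max 0 (min r (x $ i - g x $ i))" for i
    using x by (auto simp: B h_def vec_eq_iff)
  \<comment> \<open>If \<open>x $ i\<close> is positive, the clamp at 0 is inactive and
    \<open>x $ i\<close> is at most \<open>x $ i - g x $ i\<close>. Since \<open>bound\<close> asks
    only for this inequality, it applies before \<open>x\<close> is known to be a solution.\<close>
  have "x $ i * g x $ i \<le> 0" for i
    using xi[of i] by (auto simp: mult_le_0_iff max_def min_def split: if_splits)
  then have "norm x \<le> R"
    unfolding g_def by (rule bound)
  then have less: "x $ i < r" for i
    using component_le_norm_cart[of x i] by (simp add: r_def)
  \<comment> \<open>Below \<open>r\<close> the fixed point equation reads
    \<open>x $ i = max 0 (x $ i - g x $ i)\<close>, which is complementarity at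
    \<open>i\<close>.\<close>
  have "0 \<le> g x $ i \<and> x $ i * g x $ i = 0" for i
    using xi[of i] less[of i] by (auto simp: max_def min_def split: if_splits)
  then have "x \<in> PCP_solutions f q"
    using xi(1) by (simp add: PCP_solutions_iff g_def)
  then show "PCP_solutions f q \<noteq> {}"
    by blast
  have "PCP_solutions f q \<subseteq> cball 0 R"
    using bound unfolding PCP_solutions_iff subset_iff mem_cball_0 by (metis order_refl)
  then have "bounded (PCP_solutions f q)"
    using bounded_cball bounded_subset by blast
  moreover have "closed (PCP_solutions f q)"
    unfolding PCP_solutions_def
    by (intro closed_Collect_conj closed_Collect_all closed_Collect_le closed_Collect_eq
        continuous_intros cont)
  ultimately show "compact (PCP_solutions f q)"
    by (simp add: compact_eq_bounded_closed)
qed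

section \<open>A priori bound under perturbations of lower degree\<close>

lemma polynomial_map_continuous:
  assumes "polynomial_map_degree_less d P"
  shows "continuous_on UNIV P"
proof -
  have "continuous_on UNIV (\<lambda>x. P x $ i)" for i
  proof -
    obtain c where "\<And>x. P x $ i = (\<Sum>\<alpha> | (\<Sum>j\<in>UNIV. \<alpha> j) < d. c \<alpha> * (\<Prod>j\<in>UNIV. (x $ j) ^ \<alpha> j))"
      using assms unfolding polynomial_map_degree_less_def by blast
    then show ?thesis
      by (simp, intro continuous_intros)
  qed
  then have "continuous_on UNIV (\<lambda>x. \<chi> i. P x $ i)"
    by (rule continuous_on_vec_lambda)
  then show ?thesis
    by (simp only: vec_lambda_eta)
qed

text \<open>The base \<open>1 + norm x\<close> dominates every component and is at least 1, so
  monomials of smaller degree obey the same bound.\<close>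

lemma monomial_growth:
  fixes x :: "real^'n"
  assumes "(\<Sum>j\<in>UNIV. \<alpha> j) \<le> d"
  shows "\<bar>\<Prod>j\<in>UNIV. (x $ j) ^ \<alpha> j\<bar> \<le> (1 + norm x) ^ d"
proof -
  have "\<bar>\<Prod>j\<in>UNIV. (x $ j) ^ \<alpha> j\<bar> = (\<Prod>j\<in>UNIV. \<bar>x $ j\<bar> ^ \<alpha> j)"
    by (simp add: abs_prod power_abs)
  also have "\<dots> \<le> (\<Prod>j\<in>UNIV. (1 + norm x) ^ \<alpha> j)"
  proof (intro prod_mono conjI power_mono)
    show "\<bar>x $ j\<bar> \<le> 1 + norm x" for j
      using component_le_norm_cart[of x j] by simp
  qed auto
  also have "\<dots> = (1 + norm x) ^ (\<Sum>j\<in>UNIV. \<alpha> j)"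
    by (simp add: power_sum)
  also have "\<dots> \<le> (1 + norm x) ^ d"
    by (rule power_increasing[OF assms]) simp
  finally show ?thesis .
qed

lemma polynomial_map_growth:
  fixes P :: "real^'n \<Rightarrow> real^'n"
  assumes "polynomial_map_degree_less (Suc d) P"
  obtains C where "0 \<le> C" "\<And>x i. \<bar>P x $ i\<bar> \<le> C * (1 + norm x) ^ d"
proof -
  have "\<exists>C\<ge>0. \<forall>x. \<bar>P x $ i\<bar> \<le> C * (1 + norm x) ^ d" for i
  proof -
    obtain c where c: "\<And>x. P x $ i
        = (\<Sum>\<alpha> | (\<Sum>j\<in>UNIV. \<alpha> j) < Suc d. c \<alpha> * (\<Prod>j\<in>UNIV. (x $ j) ^ \<alpha> j))"
      using assms unfolding polynomial_map_degree_less_def by blast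
    let ?C = "\<Sum>\<alpha> | (\<Sum>j\<in>UNIV. \<alpha> j) < Suc d. \<bar>c \<alpha>\<bar>"
    have "\<bar>P x $ i\<bar> \<le> ?C * (1 + norm x) ^ d" for x
    proof -
      have "\<bar>P x $ i\<bar> \<le> (\<Sum>\<alpha> | (\<Sum>j\<in>UNIV. \<alpha> j) < Suc d. \<bar>c \<alpha> * (\<Prod>j\<in>UNIV. (x $ j) ^ \<alpha> j)\<bar>)"
        unfolding c by (rule sum_abs)
      also have "\<dots> \<le> (\<Sum>\<alpha> | (\<Sum>j\<in>UNIV. \<alpha> j) < Suc d. \<bar>c \<alpha>\<bar> * (1 + norm x) ^ d)"
        unfolding abs_mult by (intro sum_mono mult_left_mono monomial_growth) auto
      finally show ?thesis
        by (simp add: sum_distrib_right)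
    qed
    then show ?thesis
      by (intro exI[of _ ?C]) (auto intro: sum_nonneg)
  qed
  then obtain C where C: "\<And>i. 0 \<le> C i" "\<And>i x. \<bar>P x $ i\<bar> \<le> C i * (1 + norm x) ^ d"
    by metis
  have "\<bar>P x $ i\<bar> \<le> (\<Sum>i\<in>UNIV. C i) * (1 + norm x) ^ d" for x i
  proof -
    have "C i \<le> (\<Sum>i\<in>UNIV. C i)"
      by (rule member_le_sum) (auto simp: C(1))
    then show ?thesis
      using C(2)[of x i] by (meson mult_right_mono order_trans norm_ge_zero add_nonneg_nonneg
          zero_le_one zero_le_power)
  qed
  then show ?thesis
    using that[of "\<Sum>i\<in>UNIV. C i"] C(1) by (simp add: sum_nonneg)
qed

text \<open>Only one term \<open>x $ i * vec_power (A *v x) k $ i\<close> is known to be positive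
  and the others may outweigh it, so negative terms are cut off. The resulting sum is continuous,
  positive off the origin and homogeneous of degree \<open>k + 1\<close>; \<open>c\<close> is its
  minimum on the unit sphere.\<close>

lemma P_matrix_coercive:
  fixes A :: "real^'n^'n"
  assumes A: "P_matrix A" and k: "odd k"
  obtains c where "0 < c"
    "\<And>x. c * norm x ^ (k + 1) \<le> (\<Sum>i\<in>UNIV. max 0 (x $ i * vec_power (A *v x) k $ i))"
proof -
  define \<phi> where "\<phi> x = (\<Sum>i\<in>UNIV. max 0 (x $ i * vec_power (A *v x) k $ i))" for x :: "real^'n"
  have pos: "0 < \<phi> x" if "x \<noteq> 0" for x
  proof -
    obtain i where i: "0 < x $ i * (A *v x) $ i"
      using P_matrix_no_sign_reversal[OF A \<open>x \<noteq> 0\<close>] by blast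
    then have "0 < x $ i * ((A *v x) $ i) ^ k"
      using k by (auto simp: zero_less_mult_iff zero_less_power power_less_zero_eq)
    then have "0 < max 0 (x $ i * vec_power (A *v x) k $ i)"
      by (simp add: vec_power_def)
    then show ?thesis
      unfolding \<phi>_def by (intro sum_pos2[of _ i]) auto
  qed
  have hom: "\<phi> (t *\<^sub>R x) = t ^ (k + 1) * \<phi> x" if "0 \<le> t" for t x
  proof -
    have "max 0 ((t *\<^sub>R x) $ i * vec_power (A *v (t *\<^sub>R x)) k $ i)
        = t ^ (k + 1) * max 0 (x $ i * vec_power (A *v x) k $ i)" for i
      using that by (simp add: vec_power_def matrix_vector_mult_scaleR power_mult_distrib
          max_mult_distrib_left mult_ac)
    then show ?thesis
      by (simp add: \<phi>_def sum_distrib_left)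
  qed
  have cont: "continuous_on UNIV \<phi>"
    unfolding \<phi>_def vec_power_def
    by (simp, intro continuous_intros continuous_on_max matrix_vector_mult_linear_continuous_on)
  have "sphere (0 :: real^'n) 1 \<noteq> {}"
    using norm_axis_1 by (metis dist_0_norm empty_iff mem_sphere)
  then obtain z :: "real^'n" where z: "norm z = 1" "\<And>x. norm x = 1 \<Longrightarrow> \<phi> z \<le> \<phi> x"
    using continuous_attains_inf[OF compact_sphere, of 0 1 \<phi>] continuous_on_subset[OF cont]
    by (auto simp: dist_norm)
  have "\<phi> z * norm x ^ (k + 1) \<le> \<phi> x" for x
  proof (cases "x = 0")
    case True
    then show ?thesis
      using hom[of 0 0] by simp
  next
    case False
    have "\<phi> z \<le> \<phi> (sgn x)"
      using False by (intro z(2)) (simp add: norm_sgn)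
    then have "\<phi> z * norm x ^ (k + 1) \<le> norm x ^ (k + 1) * \<phi> (sgn x)"
      by (metis mult.commute mult_left_mono norm_ge_zero zero_le_power)
    also have "\<dots> = \<phi> (norm x *\<^sub>R sgn x)"
      by (rule hom[symmetric]) simp
    also have "norm x *\<^sub>R sgn x = x"
      using False by (simp add: sgn_div_norm)
    finally show ?thesis .
  qed
  moreover have "0 < \<phi> z"
    using z(1) by (intro pos) auto
  ultimately show ?thesis
    using that[of "\<phi> z"] by (simp add: \<phi>_def)
qed

text \<open>The sign condition bounds each positive part in the coercivity estimate by
  \<open>\<bar>x $ i\<bar> * \<bar>(P x + q) $ i\<bar>\<close>, which grows at most like
  \<open>norm x ^ k\<close>, against \<open>norm x ^ (k + 1)\<close> on the other side.\<close>

lemma P_matrix_PCP_bound: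
  fixes A :: "real^'n^'n"
  assumes A: "P_matrix A" and k: "odd k" and P: "polynomial_map_degree_less k P"
  obtains R where
    "\<And>x. (\<And>i. x $ i * (vec_power (A *v x) k + P x + q) $ i \<le> 0) \<Longrightarrow> norm x \<le> R"
proof -
  obtain d where d: "k = Suc d"
    using k by (cases k) auto
  obtain c where c: "0 < c"
    "\<And>x. c * norm x ^ (k + 1) \<le> (\<Sum>i\<in>UNIV. max 0 (x $ i * vec_power (A *v x) k $ i))"
    using P_matrix_coercive[OF A k] by blast
  obtain C where C: "0 \<le> C" "\<And>x i. \<bar>P x $ i\<bar> \<le> C * (1 + norm x) ^ d"
    using polynomial_map_growth[OF P[unfolded d]] by blast
  define n where "n = real CARD('n)"
  \<comment> \<open>The factor \<open>n\<close> comes from summing over components, and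
    \<open>2 ^ d\<close> from \<open>1 + N \<le> 2 * N\<close> outside the unit ball; inside it the
    bound 1 suffices.\<close>
  define D where "D = n * (C + norm q) * 2 ^ d"
  have "norm x \<le> max 1 (D / c)" if x: "\<And>i. x $ i * (vec_power (A *v x) k + P x + q) $ i \<le> 0" for x
  proof (cases "norm x \<le> 1")
    case False
    define N where "N = norm x"
    have N: "1 < N"
      using False by (simp add: N_def)
    have low: "\<bar>(P x + q) $ i\<bar> \<le> (C + norm q) * (1 + N) ^ d" for i
    proof -
      have "\<bar>(P x + q) $ i\<bar> \<le> \<bar>P x $ i\<bar> + \<bar>q $ i\<bar>"
        by (simp add: abs_triangle_ineq)
      also have "\<dots> \<le> C * (1 + N) ^ d + norm q * 1"
        using C(2)[of x i] component_le_norm_cart[of q i] by (simp add: N_def)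
      also have "\<dots> \<le> C * (1 + N) ^ d + norm q * (1 + N) ^ d"
        using N by (intro add_left_mono mult_left_mono one_le_power) auto
      finally show ?thesis
        by (simp add: distrib_right)
    qed
    have summand: "max 0 (x $ i * vec_power (A *v x) k $ i) \<le> N * ((C + norm q) * (1 + N) ^ d)" for i
    proof -
      have "x $ i * vec_power (A *v x) k $ i \<le> - (x $ i * (P x + q) $ i)"
        using x[of i] by (simp add: algebra_simps)
      then have "max 0 (x $ i * vec_power (A *v x) k $ i) \<le> \<bar>x $ i\<bar> * \<bar>(P x + q) $ i\<bar>"
        unfolding abs_mult[symmetric] by linarith
      also have "\<dots> \<le> N * ((C + norm q) * (1 + N) ^ d)"
        using component_le_norm_cart[of x i] low[of i] N by (intro mult_mono) (auto simp: N_def)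
      finally show ?thesis .
    qed
    have "c * N ^ (k + 1) \<le> (\<Sum>i\<in>(UNIV :: 'n set). N * ((C + norm q) * (1 + N) ^ d))"
      using c(2)[of x] unfolding N_def[symmetric] by (rule order_trans[OF _ sum_mono[OF summand]])
    also have "\<dots> = n * N * (C + norm q) * (1 + N) ^ d"
      by (simp add: n_def)
    also have "\<dots> \<le> n * N * (C + norm q) * (2 * N) ^ d"
      using N C(1) by (intro mult_left_mono power_mono) (auto simp: n_def)
    also have "\<dots> = D * N ^ k"
      by (simp add: D_def d power_mult_distrib)
    finally have "(c * N) * N ^ k \<le> D * N ^ k"
      by (simp add: mult_ac)
    then have "c * N \<le> D"
      using N by simp
    then show ?thesis
      using c(1) by (simp add: N_def field_simps le_max_iff_disj)
  qed simp
  then show ?thesis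
    using that by blast
qed

theorem proposition6p3:
  fixes A :: "real^'n^'n" and k :: nat and T :: "'n tensor"
  assumes "P_matrix A"
    and "odd k"
    and "\<forall>x. tensor_map (k + 1) T x = vec_power (A *v x) k"
  shows "GUS_property (k + 1) T \<and> strong_Q_property (k + 1) T"
proof
  have T: "tensor_map (k + 1) T = (\<lambda>x. vec_power (A *v x) k)"
    using assms(3) by blast
  have contF: "continuous_on UNIV (\<lambda>x. vec_power (A *v x) k)"
    unfolding vec_power_def by (intro continuous_intros matrix_vector_mult_linear_continuous_on)
  \<comment> \<open>This conjunct comes first because existence in the GUS-property is its case
    \<open>P = 0\<close>.\<close>
  show Q: "strong_Q_property (k + 1) T"
    unfolding strong_Q_property_def T add_diff_cancel_right'
  proof (intro allI impI)
    fix P :: "real^'n \<Rightarrow> real^'n" and q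
    assume P: "polynomial_map_degree_less k P"
    obtain R where R: "\<And>x. (\<And>i. x $ i * (vec_power (A *v x) k + P x + q) $ i \<le> 0) \<Longrightarrow> norm x \<le> R"
      using P_matrix_PCP_bound[OF assms(1,2) P] by blast
    then show "PCP_solutions (\<lambda>x. vec_power (A *v x) k + P x) q \<noteq> {}
        \<and> compact (PCP_solutions (\<lambda>x. vec_power (A *v x) k + P x) q)"
      by (intro PCP_solutions_nonempty_compact[OF _ R] continuous_on_add contF
          polynomial_map_continuous[OF P])
  qed
  have "polynomial_map_degree_less k (\<lambda>x :: real^'n. 0)"
    unfolding polynomial_map_degree_less_def by (auto intro!: exI[of _ "\<lambda>_. 0"])
  then have "PCP_solutions (\<lambda>x. vec_power (A *v x) k) q \<noteq> {}" for q
    using Q[unfolded strong_Q_property_def T add_diff_cancel_right', rule_format, of "\<lambda>x. 0" q] by simp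
  then show "GUS_property (k + 1) T"
    unfolding GUS_property_def T using PCP_vec_power_unique[OF assms(1,2)] by blast
qed

end
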